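(* Let $(\mathcal Q,\mathfrak S,\mathfrak S_0,U_t,R,\mu_{r,\theta})$, $(r,\theta)\in\mathbb R^2$ (polar-type coordinates), be the family of path spaces of the component states $\psi_{r,\theta}$ of the BEC state $\psi_{\rm BEC}$. Then the measurable space corresponding to $\psi_{\rm BEC}$ is $(\mathcal Q\times\mathbb R^2,\ \mathfrak S\otimes\mathcal B(\mathbb R^2))$, with probability measure obtained from the regular conditional probability $\mu_{r,\theta}$ by $$\mu(A\times B)=\int_B\mu_{r,\theta}(A)\,d\chi(r,\theta),\qquad A\in\mathfrak S,\ B\in\mathcal B(\mathbb R^2).$$ In particular, for every $\mathfrak S$-measurable $F$ for which the integral is meaningful, $$\mathbb E_\mu[F]=\int_{\mathbb R^2}\mathbb E_{\mu_{r,\theta}}[F]\,d\chi(r,\theta).$$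
   Context: Setting: $d=3$, $s\ge1$, $h(k)=|k|^s$, $\beta>0$, condensate density $\rho_0(\beta)>0$. $\hat f(k)=(2\pi)^{-d/2}\int e^{-ik\cdot x}f\,dx$; $q_{\rm nz}(f)=\int\coth(\beta h/2)|\hat f|^2dk$; $q_0(f)=2(2\pi)^d\rho_0(\beta)|\hat f(0)|^2$; $\mathcal D_0=\{f\in L^1\cap L^2:q_{\rm nz}(f)<\infty\}$; $\ell_{r,\theta}(f)=\sqrt{2(2\pi)^d\rho_0(\beta)r}\,\mathrm{Re}(e^{i\theta}\hat f(0))$. $\chi$ is the probability measure $e^{-r}dr\,\frac{d\theta}{2\pi}$ on $[0,\infty)\times[0,2\pi)$, regarded as a measure on $\mathbb R^2$. $\psi_{\rm BEC}(W(f))=e^{-\frac14(q_0(f)+q_{\rm nz}(f))}$, $\psi_{r,\theta}(W(f))=e^{-\frac14q_{\rm nz}(f)+i\ell_{r,\theta}(f)}$ on Weyl operators. Path-space family: $\mathcal Q$ is a separable real Hilbert space with countably generated $\sigma$-algebra $\mathfrak S$, sub-$\sigma$-algebra $\mathfrak S_0$ generated by time-zero fields $\phi(f)$ ($f\in\mathcal D_0$ real), time translations $U_t$ and reflection $R$, all independent of $(r,\theta)$; $\mu_{r,\theta}$ is a Gaussian probability measure on $(\mathcal Q,\mathfrak S)$ with $\mathbb E_{\mu_{r,\theta}}[e^{it\phi(f)}]=\exp(-\frac{t^2}4q_{\rm nz}(f)+it\ell_{r,\theta}(f))$, making $(\mathcal Q,\mathfrak S,\mathfrak S_0,U_t,R,\mu_{r,\theta})$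 a $\beta$-Markov path space (stationary, $\beta$-periodic, reflection-invariant, two-sided Markov on the circle of length $\beta$), and $(r,\theta)\mapsto\mu_{r,\theta}(A)$ is Borel measurable for each $A$, i.e. a transition probability. "Corresponding to $\psi_{\rm BEC}$" means that time-zero expectations $\mathbb E_\mu[e^{i\phi(f)}]$ equal $\psi_{\rm BEC}(W(f))$ for real $f\in\mathcal D_0$. An $\mathfrak S$-measurable $F$ on $\mathcal Q$ is viewed as a function on $\mathcal Q\times\mathbb R^2$ not depending on the second variable. *)

theory Defs
  imports "HOL-Probability.Probability"
begin

type_synonym R3 = "real ^ 3"


section \<open>The BEC state and its components on Weyl operators\<close>

definition fourier :: "(R3 \<Rightarrow> complex) \<Rightarrow> R3 \<Rightarrow> complex" where
  "fourier f k = of_real ((2 * pi) powr (- 3 / 2)) * (LINT x|lborel. exp (- \<i> * of_real (k \<bullet> x)) * f x)"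

definition coth :: "real \<Rightarrow> real" where
  "coth x = cosh x / sinh x"

definition disp :: "real \<Rightarrow> R3 \<Rightarrow> real" where
  "disp s k = norm k powr s"

definition qnz_density :: "real \<Rightarrow> real \<Rightarrow> (R3 \<Rightarrow> complex) \<Rightarrow> R3 \<Rightarrow> real" where
  "qnz_density \<beta> s f k = coth (\<beta> * disp s k / 2) * (cmod (fourier f k))\<^sup>2"

(* The real value is meaningful only on D0 below, where the density is integrable. *)
definition q_nz :: "real \<Rightarrow> real \<Rightarrow> (R3 \<Rightarrow> complex) \<Rightarrow> real" where
  "q_nz \<beta> s f = (LINT k|lborel. qnz_density \<beta> s f k)"

(* rho0 is the value of the condensate density at the fixed inverse temperature. *)
definition q_0 :: "real \<Rightarrow> (R3 \<Rightarrow> complex) \<Rightarrow> real" where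
  "q_0 \<rho>0 f = 2 * (2 * pi) ^ 3 * \<rho>0 * (cmod (fourier f 0))\<^sup>2"

(* The density is nonnegative, so its integrability is the finiteness of q_nz. *)
definition D0 :: "real \<Rightarrow> real \<Rightarrow> (R3 \<Rightarrow> complex) set" where
  "D0 \<beta> s = {f. integrable lborel f \<and> integrable lborel (\<lambda>x. (cmod (f x))\<^sup>2)
                \<and> integrable lborel (qnz_density \<beta> s f)}"

abbreviation cplx :: "(R3 \<Rightarrow> real) \<Rightarrow> R3 \<Rightarrow> complex" where
  "cplx f \<equiv> (\<lambda>x. complex_of_real (f x))"

definition D0_real :: "real \<Rightarrow> real \<Rightarrow> (R3 \<Rightarrow> real) set" where
  "D0_real \<beta> s = {f. cplx f \<in> D0 \<beta> s}"

definition ell :: "real \<Rightarrow> real \<Rightarrow> real \<Rightarrow> (R3 \<Rightarrow> complex) \<Rightarrow> real" where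
  "ell \<rho>0 r \<theta> f = sqrt (2 * (2 * pi) ^ 3 * \<rho>0 * r) * Re (exp (\<i> * of_real \<theta>) * fourier f 0)"

(* A state enters only through its values on Weyl operators: psi_BEC _ _ _ f is the value
   of the BEC state at W(f), and similarly for the component states. *)
definition psi_BEC :: "real \<Rightarrow> real \<Rightarrow> real \<Rightarrow> (R3 \<Rightarrow> complex) \<Rightarrow> complex" where
  "psi_BEC \<beta> s \<rho>0 f = exp (of_real (- (1 / 4) * (q_0 \<rho>0 f + q_nz \<beta> s f)))"

definition psi_component ::
  "real \<Rightarrow> real \<Rightarrow> real \<Rightarrow> real \<Rightarrow> real \<Rightarrow> (R3 \<Rightarrow> complex) \<Rightarrow> complex" where
  "psi_component \<beta> s \<rho>0 r \<theta> f =
     exp (of_real (- (1 / 4) * q_nz \<beta> s f) + \<i> * of_real (ell \<rho>0 r \<theta> f))"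

definition polar_strip :: "(real \<times> real) set" where
  "polar_strip = {0..} \<times> {0..<2 * pi}"

(* The coordinates (r, \<theta>) are used as Cartesian coordinates of the plane: there is no
   polar change of variables, and chi gives no mass to the complement of polar_strip. *)
definition chi :: "(real \<times> real) measure" where
  "chi = density lborel
           (\<lambda>(r, \<theta>). ennreal (indicator polar_strip (r, \<theta>) * (exp (- r) / (2 * pi))))"


section \<open>Path spaces\<close>

definition countably_generated :: "'a measure \<Rightarrow> bool" where
  "countably_generated S \<longleftrightarrow>
     (\<exists>G. countable G \<and> G \<subseteq> Pow (space S) \<and> sets S = sigma_sets (space S) G)"

(* Gaussian measure on a Hilbert space: every continuous linear functional is a
   normal random variable, constants being allowed as degenerate normal variables. *)
definition gaussian_measure :: "'q::real_inner measure \<Rightarrow> bool" where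
  "gaussian_measure M \<longleftrightarrow> prob_space M \<and>
     (\<forall>v. (\<lambda>x. v \<bullet> x) \<in> borel_measurable M \<and>
       (\<exists>m. (AE x in M. v \<bullet> x = m) \<or>
            (\<exists>\<sigma>>0. distributed M lborel (\<lambda>x. v \<bullet> x) (normal_density m \<sigma>))))"

definition time_zero_algebra ::
  "(R3 \<Rightarrow> real) set \<Rightarrow> ((R3 \<Rightarrow> real) \<Rightarrow> 'q \<Rightarrow> real) \<Rightarrow> 'q measure" where
  "time_zero_algebra D \<phi> = sigma UNIV {\<phi> f -` B | f B. f \<in> D \<and> B \<in> sets borel}"

(* The sigma-algebra generated by the fields at times in I: the automorphism U_t acts on
   random variables by F \<mapsto> F \<circ> U t. *)
definition time_algebra :: "'q measure \<Rightarrow> (real \<Rightarrow> 'q \<Rightarrow> 'q) \<Rightarrow> real set \<Rightarrow> 'q measure" where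
  "time_algebra S0 U I = sigma UNIV {U t -` A | t A. t \<in> I \<and> A \<in> sets S0}"

(* All relations between the maps U t and R, as well as the generation of the
   sigma-algebra by the translates of S0, are required modulo null sets, since they are
   relations between automorphisms of the L-infinity space of M. The circle of length \<beta>
   is [-\<beta>/2, \<beta>/2] with its end points identified; the Markov property says that the two
   semicircles are independent conditionally on their common boundary {0, \<beta>/2}. *)
locale beta_markov_path_space = prob_space M
  for M :: "'q measure" and S0 :: "'q measure"
    and U :: "real \<Rightarrow> 'q \<Rightarrow> 'q" and R :: "'q \<Rightarrow> 'q" and \<beta> :: real +
  assumes space_UNIV: "space M = UNIV"
    and sub_algebra: "subalgebra M S0"
    and U_measurable: "\<And>t. U t \<in> measurable M M"
    and stationary: "\<And>t. distr M M (U t) = M"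
    and U_zero: "AE x in M. U 0 x = x"
    and U_add: "\<And>t u. AE x in M. U (t + u) x = U t (U u x)"
    and U_continuous: "\<And>F \<epsilon>. F \<in> borel_measurable M \<Longrightarrow> \<epsilon> > (0::real) \<Longrightarrow>
      ((\<lambda>t. measure M {x \<in> space M. \<bar>F (U t x) - F x\<bar> > \<epsilon>}) \<longlongrightarrow> 0) (at 0)"
    and generates: "\<And>A. A \<in> sets M \<Longrightarrow>
      \<exists>B \<in> sets (time_algebra S0 U UNIV). emeasure M ((A - B) \<union> (B - A)) = 0"
    and R_measurable: "R \<in> measurable M M"
    and R_invariant: "distr M M R = M"
    and R_involution: "AE x in M. R (R x) = x"
    and R_U: "\<And>t. AE x in M. R (U t x) = U (- t) (R x)"
    and R_time_zero: "\<And>A. A \<in> sets S0 \<Longrightarrow> emeasure M ((R -` A - A) \<union> (A - R -` A)) = 0"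
    and periodic: "AE x in M. U \<beta> x = x"
    and markov: "\<And>F. integrable M F \<Longrightarrow>
      AE x in M.
        real_cond_exp M (time_algebra S0 U {0..\<beta> / 2})
          (real_cond_exp M (time_algebra S0 U {- \<beta> / 2..0}) F) x
        = real_cond_exp M (time_algebra S0 U {0, \<beta> / 2}) F x"

definition corresponds_to ::
  "'w measure \<Rightarrow> (R3 \<Rightarrow> real) set \<Rightarrow> ((R3 \<Rightarrow> real) \<Rightarrow> 'w \<Rightarrow> real) \<Rightarrow> ((R3 \<Rightarrow> complex) \<Rightarrow> complex) \<Rightarrow> bool"
  where
  "corresponds_to M D \<phi> \<psi> \<longleftrightarrow>
     (\<forall>f\<in>D. (LINT x|M. exp (\<i> * of_real (\<phi> f x))) = \<psi> (cplx f))"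

(* The path space family over the plane. The transition probability is indexed by the whole
   plane; the other conditions only concern polar_strip, which carries chi and on which ell
   is defined. *)
locale component_path_spaces =
  fixes \<beta> s \<rho>0 :: real
    and S :: "'q::{real_inner, banach, second_countable_topology} measure"
    and \<phi> :: "(R3 \<Rightarrow> real) \<Rightarrow> 'q \<Rightarrow> real"
    and U :: "real \<Rightarrow> 'q \<Rightarrow> 'q" and R :: "'q \<Rightarrow> 'q"
    and \<mu> :: "real \<times> real \<Rightarrow> 'q measure"
  assumes space_S: "space S = UNIV"
    and S_countably_generated: "countably_generated S"
    and transition_probability: "\<mu> \<in> measurable borel (prob_algebra S)"
    and gaussian: "\<And>r \<theta>. (r, \<theta>) \<in> polar_strip \<Longrightarrow> gaussian_measure (\<mu> (r, \<theta>))"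
    and fields: "\<And>r \<theta> f t. (r, \<theta>) \<in> polar_strip \<Longrightarrow> f \<in> D0_real \<beta> s \<Longrightarrow>
      (LINT x|\<mu> (r, \<theta>). exp (\<i> * of_real (t * \<phi> f x)))
      = exp (of_real (- (t\<^sup>2 / 4) * q_nz \<beta> s (cplx f)) + \<i> * of_real (t * ell \<rho>0 r \<theta> (cplx f)))"
    and component: "\<And>r \<theta>. (r, \<theta>) \<in> polar_strip \<Longrightarrow>
      corresponds_to (\<mu> (r, \<theta>)) (D0_real \<beta> s) \<phi> (psi_component \<beta> s \<rho>0 r \<theta>)"
    and path_space: "\<And>r \<theta>. (r, \<theta>) \<in> polar_strip \<Longrightarrow>
      beta_markov_path_space (\<mu> (r, \<theta>)) (time_zero_algebra (D0_real \<beta> s) \<phi>) U R \<beta>"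

definition is_mixture ::
  "'q measure \<Rightarrow> (real \<times> real \<Rightarrow> 'q measure) \<Rightarrow> ('q \<times> (real \<times> real)) measure \<Rightarrow> bool" where
  "is_mixture S \<mu> M \<longleftrightarrow>
     sets M = sets (S \<Otimes>\<^sub>M borel) \<and> prob_space M \<and>
     (\<forall>A\<in>sets S. \<forall>B\<in>sets borel. measure M (A \<times> B) = (LINT z:B|chi. measure (\<mu> z) A))"

end

theory Submission
  imports Defs
begin

text \<open>A mixture exists and is unique because \<open>\<mu>\<close> is a kernel and rectangles generate the product
  \<open>\<sigma>\<close>-algebra; its first marginal is \<open>chi \<bind> \<mu>\<close>, so integrals over it disintegrate. Time-zero
  expectations thereby reduce to averaging the phase \<open>exp (\<i> * ell)\<close> over \<open>chi\<close>. Expanding the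
  exponential, the average over the angle leaves only the even moments, which gives the Bessel series
  \<open>\<Sum>m. (- K * r) ^ m / (m!)\<^sup>2\<close> with \<open>K = q_0 / 4\<close>; integrating against \<open>exp (- r)\<close> cancels one
  factorial and leaves \<open>exp (- K)\<close>.\<close>

section \<open>Integration against the bind of a measure with a kernel\<close>

text \<open>Tonelli applied to \<open>norm (f x)\<close>: the iterated integral is finite, so the
  inner one is finite for almost every \<open>z\<close>, and it dominates the norm of the inner
  Bochner integral.\<close>

lemma
  fixes f :: "'a \<Rightarrow> 'b::{banach, second_countable_topology}"
  assumes K: "K \<in> measurable M (subprob_algebra N)" and M: "space M \<noteq> {}"
    and f: "integrable (M \<bind> K) f"
  shows AE_integrable_bind: "AE z in M. integrable (K z) f"
    and integrable_integral_bind: "integrable M (\<lambda>z. LINT x|K z. f x)"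
proof -
  have [measurable]: "f \<in> borel_measurable N"
    using borel_measurable_integrable[OF f] sets_bind_measurable[OF K M]
    by (simp cong: measurable_cong_sets)
  note measurable_compose[OF K nn_integral_measurable_subprob_algebra, measurable]
  note measurable_compose[OF K integral_measurable_subprob_algebra, measurable]
  have meas: "f \<in> borel_measurable (K z)" if "z \<in> space M" for z
    using sets_kernel[OF K that] by (simp cong: measurable_cong_sets)
  have fin: "(\<integral>\<^sup>+z. (\<integral>\<^sup>+x. norm (f x) \<partial>K z) \<partial>M) < \<infinity>"
    using f by (simp add: nn_integral_bind[OF _ K, symmetric] integrable_iff_bounded)
  then have "AE z in M. (\<integral>\<^sup>+x. norm (f x) \<partial>K z) \<noteq> \<infinity>"
    by (intro nn_integral_PInf_AE) simp_all
  with AE_space show ae: "AE z in M. integrable (K z) f"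
    by eventually_elim (simp add: integrable_iff_bounded meas less_top)
  have "(\<integral>\<^sup>+z. norm (LINT x|K z. f x) \<partial>M) \<le> (\<integral>\<^sup>+z. (\<integral>\<^sup>+x. norm (f x) \<partial>K z) \<partial>M)"
    using ae by (auto intro!: nn_integral_mono_AE integral_norm_bound_ennreal)
  with fin show "integrable M (\<lambda>z. LINT x|K z. f x)"
    by (simp add: integrable_iff_bounded)
qed

text \<open>Induction over integrable functions: scaled indicators, sums, dominated limits. Inner
  integrability is known only almost everywhere, so inner integrals are manipulated up to null sets
  of \<open>z\<close>.\<close>

lemma lebesgue_integral_bind:
  fixes f :: "'a \<Rightarrow> 'b::{banach, second_countable_topology}"
  assumes K: "K \<in> measurable M (subprob_algebra N)" and M: "space M \<noteq> {}"
    and f: "integrable (M \<bind> K) f"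
  shows "(LINT x|(M \<bind> K). f x) = (LINT z|M. (LINT x|K z. f x))"
  using f
proof induct
  note ae = AE_integrable_bind[OF K M] and int = integrable_integral_bind[OF K M]
  have sets_K: "sets (K z) = sets (M \<bind> K)" if "z \<in> space M" for z
    using sets_kernel[OF K that] sets_bind_measurable[OF K M] by simp
  then have space_K: "space (K z) = space (M \<bind> K)" if "z \<in> space M" for z
    using that by (blast dest: sets_eq_imp_space_eq)
  {
    case (base A c)
    have A: "A \<in> sets N"
      using base(1) sets_bind_measurable[OF K M] by simp
    note measurable_compose[OF K measurable_measure_subprob_algebra[OF A], measurable]
    have fin: "emeasure (K z) A = ennreal (measure (K z) A)" if "z \<in> space M" for z
      using subprob_measurableD(1)[OF K that] subprob_space_kernel[OF K that]
      by (simp add: subprob_space_def finite_measure.emeasure_eq_measure)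
    \<comment> \<open>The nonnegative formula for the measure of \<open>A\<close> has a finite left
      side by the induction hypothesis. This yields integrability of \<open>measure (K z) A\<close>
      and allows passing to real integrals.\<close>
    have eq: "ennreal (measure (M \<bind> K) A) = (\<integral>\<^sup>+z. measure (K z) A \<partial>M)"
      using base(2) by (subst emeasure_eq_ennreal_measure[symmetric])
        (auto simp: emeasure_bind[OF M K A] fin intro!: nn_integral_cong)
    then have int': "integrable M (\<lambda>z. measure (K z) A)"
      by (simp add: integrable_iff_bounded flip: eq)
    have "measure (M \<bind> K) A = (LINT z|M. measure (K z) A)"
      using eq by (subst (asm) nn_integral_eq_integral[OF int']) (auto intro: integral_nonneg)
    moreover have "(LINT x|K z. indicator A x *\<^sub>R c) = measure (K z) A *\<^sub>R c"
      if "z \<in> space M" for z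
      using base(1) sets_K[OF that] fin[OF that] by simp
    ultimately show ?case
      using base int' by (simp cong: Bochner_Integration.integral_cong)
  next
    case (add f g)
    \<comment> \<open>Where \<open>f\<close> or \<open>g\<close> is not integrable under
      \<open>K z\<close>, the Bochner integral defaults to 0 and additivity may fail; these
      \<open>z\<close> form a null set.\<close>
    have "AE z in M. (LINT x|K z. f x + g x) = (LINT x|K z. f x) + (LINT x|K z. g x)"
      using ae[OF add(1)] ae[OF add(3)] by eventually_elim simp
    then have "(LINT z|M. (LINT x|K z. f x + g x)) =
        (LINT z|M. (LINT x|K z. f x) + (LINT x|K z. g x))"
      using int[OF add(1)] int[OF add(3)] int[OF Bochner_Integration.integrable_add[OF add(1,3)]]
      by (intro integral_cong_AE) auto
    with add int[OF add(1)] int[OF add(3)] show ?case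
      by simp
  next
    case (lim f s)
    show ?case
    proof (rule LIMSEQ_unique)
      show "(\<lambda>i. LINT x|(M \<bind> K). s i x) \<longlonglongrightarrow> (LINT x|(M \<bind> K). f x)"
        using lim by (intro integral_dominated_convergence[where w="\<lambda>x. 2 * norm (f x)"]) auto
      \<comment> \<open>Dominated convergence is used twice: inside for almost every
        \<open>z\<close> with bound \<open>2 * norm (f x)\<close>, and outside with the integral of
        that bound. The factor 2 comes from the approximants supplied by the induction rule.\<close>
      have "(\<lambda>i. LINT z|M. (LINT x|K z. s i x)) \<longlonglongrightarrow> (LINT z|M. (LINT x|K z. f x))"
      proof (rule integral_dominated_convergence)
        show "integrable M (\<lambda>z. LINT x|K z. 2 * norm (f x))"
          using lim(5) by (intro int) auto
        \<comment> \<open>Countably many exceptional sets are merged into one null set, so that a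
          single \<open>z\<close> serves the whole sequence.\<close>
        have "AE z in M. \<forall>i. integrable (K z) (s i)"
          unfolding AE_all_countable using ae[OF lim(1)] ..
        with AE_space ae[OF lim(5)]
        show "AE z in M. (\<lambda>i. LINT x|K z. s i x) \<longlonglongrightarrow> (LINT x|K z. f x)"
        proof eventually_elim
          case (elim z)
          then show ?case
            using lim(3,4) space_K
            by (intro integral_dominated_convergence[where w="\<lambda>x. 2 * norm (f x)"])
              (auto intro: borel_measurable_integrable)
        qed
        show "AE z in M. norm (LINT x|K z. s i x) \<le> (LINT x|K z. 2 * norm (f x))" for i
          using AE_space ae[OF lim(5)] ae[OF lim(1)[of i]]
        proof eventually_elim
          case (elim z)
          have "norm (LINT x|K z. s i x) \<le> (LINT x|K z. norm (s i x))"
            by (rule integral_norm_bound)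
          also have "\<dots> \<le> (LINT x|K z. 2 * norm (f x))"
            using elim lim(4) space_K by (intro integral_mono) auto
          finally show ?case .
        qed
      qed (use int[OF lim(5)] int[OF lim(1)] in auto)
      then show "(\<lambda>i. LINT x|(M \<bind> K). s i x) \<longlonglongrightarrow> (LINT z|M. (LINT x|K z. f x))"
        using lim(2) by simp
    qed
  }
qed

section \<open>Fourier modes and moments on the circle\<close>

text \<open>For \<open>k \<noteq> 0\<close> the antiderivative, obtained by dividing by
  \<open>\<i> * k\<close>, is \<open>2 * pi\<close>-periodic, so its boundary values cancel. The
  interval is closed to fit the fundamental theorem of calculus.\<close>

lemma has_bochner_integral_exp_int_multiple:
  fixes k :: int
  shows "has_bochner_integral lborel (\<lambda>\<theta>. indicator {0..2 * pi} \<theta> *\<^sub>R exp (\<i> * of_int k * of_real \<theta>))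
    (if k = 0 then of_real (2 * pi) else (0 :: complex))"
proof (cases "k = 0")
  case True
  have "has_bochner_integral lborel (\<lambda>\<theta>. indicator {0..2 * pi} \<theta> *\<^sub>R (1 :: complex)) (measure lborel {0..2 * pi} *\<^sub>R 1)"
    by (intro has_bochner_integral_indicator) auto
  then show ?thesis using True by (simp add: scaleR_conv_of_real)
next
  case False
  have "has_bochner_integral lborel (\<lambda>\<theta>. indicator {0..2 * pi} \<theta> *\<^sub>R exp (\<i> * of_int k * of_real \<theta>))
      (exp (\<i> * of_int k * of_real (2 * pi)) / (\<i> * of_int k) - exp (\<i> * of_int k * of_real 0) / (\<i> * of_int k))"
    using False
  proof (intro has_bochner_integral_FTC_Icc)
    show "continuous_on {0..2 * pi} (\<lambda>\<theta>. exp (\<i> * of_int k * of_real \<theta>) :: complex)"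
      by (intro continuous_intros)
    \<comment> \<open>The antiderivative is differentiated in a complex variable and then restricted
      to the real line.\<close>
    have *: "((\<lambda>z. exp (\<i> * of_int k * z) / (\<i> * of_int k)) has_field_derivative
        exp (\<i> * of_int k * of_real x)) (at (of_real x))" for x
      using False by (auto intro!: derivative_eq_intros)
    show "((\<lambda>x. exp (\<i> * of_int k * of_real x) / (\<i> * of_int k)) has_vector_derivative
        exp (\<i> * of_int k * of_real x)) (at x within {0..2 * pi})" for x :: real
      by (rule has_vector_derivative_real_field[OF *])
  qed simp
  moreover have "exp (\<i> * of_int k * of_real (2 * pi)) = 1"
    by (auto simp: exp_eq_1 intro!: exI[of _ k])
  ultimately show ?thesis using False by simp
qed

text \<open>The interval is half-open to match the angular factor of
  \<open>polar_strip\<close>.\<close>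

abbreviation circle :: "real measure" where
  "circle \<equiv> uniform_measure lborel {0..<2 * pi}"

abbreviation exponential :: "real measure" where
  "exponential \<equiv> density lborel (exponential_density 1)"

interpretation circle: prob_space circle
  by (rule prob_space_uniform_measure) auto

interpretation exponential: prob_space exponential
  by (rule prob_space_exponential_density) simp

lemma integrable_circle_bounded:
  fixes f :: "real \<Rightarrow> 'b::{banach, second_countable_topology}"
  assumes "f \<in> borel_measurable borel" and "\<And>\<theta>. norm (f \<theta>) \<le> B"
  shows "integrable circle f"
  using assms by (intro circle.integrable_const_bound[where B = B]) auto

lemma integral_circle:
  fixes f :: "real \<Rightarrow> complex"
  assumes f [measurable]: "f \<in> borel_measurable borel"
  shows "(LINT \<theta>|circle. f \<theta>) = (LINT \<theta>|lborel. indicator {0..2 * pi} \<theta> *\<^sub>R f \<theta>) / (2 * pi)"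
proof -
  have "circle = density lborel (\<lambda>\<theta>. ennreal (indicator {0..<2 * pi} \<theta> / (2 * pi)))"
    unfolding uniform_measure_def
    by (intro density_cong AE_I2) (auto simp: indicator_def divide_ennreal simp flip: ennreal_1)
  then have "(LINT \<theta>|circle. f \<theta>) = (LINT \<theta>|lborel. (indicator {0..<2 * pi} \<theta> / (2 * pi)) *\<^sub>R f \<theta>)"
    by (simp add: integral_density)
  also have "\<dots> = (LINT \<theta>|lborel. (indicator {0..2 * pi} \<theta> *\<^sub>R f \<theta>) / (2 * pi))"
  proof (intro integral_cong_AE)
    show "AE \<theta> in lborel. (indicator {0..<2 * pi} \<theta> / (2 * pi)) *\<^sub>R f \<theta> =
        (indicator {0..2 * pi} \<theta> *\<^sub>R f \<theta>) / (2 * pi)"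
      \<comment> \<open>The half-open and the closed interval differ only in the null set
        \<open>{2 * pi}\<close>.\<close>
      using AE_lborel_singleton[of "2 * pi"]
      by eventually_elim (auto simp: indicator_def scaleR_conv_of_real)
  qed simp_all
  finally show ?thesis by simp
qed

lemma integral_circle_exp:
  fixes k :: int
  shows "(LINT \<theta>|circle. exp (\<i> * of_int k * of_real \<theta>)) = (if k = 0 then 1 else 0 :: complex)"
proof -
  have "(\<lambda>\<theta>. exp (\<i> * of_int k * of_real \<theta>) :: complex) \<in> borel_measurable borel"
    by (intro borel_measurable_continuous_onI continuous_intros)
  from integral_circle[OF this] show ?thesis
    using has_bochner_integral_integral_eq[OF has_bochner_integral_exp_int_multiple[of k]] by simp
qed

text \<open>With the real part written as half of \<open>z + cnj z\<close>, the binomial theorem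
  gives a trigonometric polynomial in \<theta> with frequencies \<open>2 * k - n\<close>. Only the
  zero frequency survives, which requires \<open>n\<close> even and
  \<open>k = n / 2\<close>.\<close>

lemma integral_circle_Re_power:
  fixes w :: complex
  shows "(LINT \<theta>|circle. complex_of_real (Re (exp (\<i> * of_real \<theta>) * w)) ^ n) =
    (if even n then of_nat (n choose (n div 2)) * of_real (cmod w / 2) ^ n else 0)"
proof -
  have expand: "complex_of_real (Re (exp (\<i> * of_real \<theta>) * w)) ^ n =
      (\<Sum>k\<le>n. of_nat (n choose k) * w ^ k * cnj w ^ (n - k) / 2 ^ n *
        exp (\<i> * of_int (2 * int k - int n) * of_real \<theta>))" for \<theta>
  proof -
    let ?z = "exp (\<i> * of_real \<theta>) * w"
    have "complex_of_real (Re ?z) = (?z + cnj ?z) / 2"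
      by (simp only: complex_add_cnj) simp
    then have "complex_of_real (Re ?z) ^ n = (\<Sum>k\<le>n. of_nat (n choose k) * ?z ^ k * cnj ?z ^ (n - k)) / 2 ^ n"
      by (simp only: power_divide binomial_ring)
    moreover have "?z ^ k * cnj ?z ^ (n - k) =
        w ^ k * cnj w ^ (n - k) * exp (\<i> * of_int (2 * int k - int n) * of_real \<theta>)" if "k \<le> n" for k
    proof -
      have "exp (\<i> * of_real \<theta>) ^ k * cnj (exp (\<i> * of_real \<theta>)) ^ (n - k) =
          exp (of_nat k * (\<i> * of_real \<theta>) + of_nat (n - k) * (- \<i> * of_real \<theta>))"
      proof -
        have "cnj (exp (\<i> * of_real \<theta>)) = exp (- \<i> * of_real \<theta>)"
          by (simp add: exp_cnj)
        then show ?thesis by (simp only: exp_add exp_of_nat_mult)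
      qed
      also have "of_nat k * (\<i> * of_real \<theta>) + of_nat (n - k) * (- \<i> * of_real \<theta>) =
          \<i> * of_int (2 * int k - int n) * of_real \<theta>"
        using that by (simp add: of_nat_diff algebra_simps)
      finally show ?thesis by (simp add: power_mult_distrib mult_ac)
    qed
    ultimately show ?thesis
      by (simp add: sum_divide_distrib mult.assoc)
  qed
  have int: "integrable circle (\<lambda>\<theta>. c * exp (\<i> * of_int k * of_real \<theta>) :: complex)" for c k
    by (intro integrable_circle_bounded[where B = "cmod c"] borel_measurable_continuous_onI continuous_intros)
      (simp add: norm_mult)
  have "(LINT \<theta>|circle. complex_of_real (Re (exp (\<i> * of_real \<theta>) * w)) ^ n) =
      (\<Sum>k\<le>n. of_nat (n choose k) * w ^ k * cnj w ^ (n - k) / 2 ^ n * (if 2 * int k - int n = 0 then 1 else 0))"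
    unfolding expand
    by (subst Bochner_Integration.integral_sum[OF int])
      (simp only: integral_mult_right_zero integral_circle_exp)
  also have "\<dots> = (if even n then of_nat (n choose (n div 2)) * of_real (cmod w / 2) ^ n else 0)"
  proof (cases "even n")
    case True
    then obtain m where n: "n = 2 * m" by (elim evenE)
    \<comment> \<open>At the surviving index \<open>k = m\<close> the powers of \<open>w\<close> and
      \<open>cnj w\<close> agree and pair up to a power of \<open>w * cnj w\<close>, the squared
      modulus.\<close>
    have "(\<Sum>k\<le>n. of_nat (n choose k) * w ^ k * cnj w ^ (n - k) / 2 ^ n * (if 2 * int k - int n = 0 then 1 else 0)) =
        (\<Sum>k\<le>n. if k = m then of_nat (n choose m) * (w * cnj w) ^ m / 2 ^ n else 0)"
      by (intro sum.cong) (auto simp: n power_mult_distrib)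
    also have "\<dots> = of_nat (n choose m) * (w * cnj w) ^ m / 2 ^ n"
      by (simp add: n)
    also have "(w * cnj w) ^ m = of_real (cmod w) ^ n"
      by (simp only: complex_norm_square[symmetric] n power_mult of_real_power)
    finally show ?thesis by (simp add: n power_divide)
  next
    case False
    then have "2 * int k - int n \<noteq> 0" for k by presburger
    then show ?thesis using False by simp
  qed
  finally show ?thesis .
qed

text \<open>The series is that of the Bessel function J_0 at \<open>t * cmod w\<close>. It arises by
  integrating the exponential series term by term.\<close>

lemma circle_characteristic_sums:
  fixes w :: complex and t :: real
  shows "(\<lambda>m. of_real ((- (t\<^sup>2 * (cmod w)\<^sup>2 / 4)) ^ m / (fact m)\<^sup>2)) sums
    (LINT \<theta>|circle. exp (\<i> * of_real (t * Re (exp (\<i> * of_real \<theta>) * w))))"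
proof -
  let ?x = "\<lambda>\<theta>. Re (exp (\<i> * of_real \<theta>) * w)"
  define f :: "nat \<Rightarrow> real \<Rightarrow> complex" where "f n \<theta> = (\<i> * of_real (t * ?x \<theta>)) ^ n /\<^sub>R fact n" for n \<theta>
  \<comment> \<open>This bound is uniform in \<theta> and consists of the terms of the series of
    \<open>exp (\<bar>t\<bar> * cmod w)\<close>; it justifies exchanging sum and integral.\<close>
  have bound: "norm (f n \<theta>) \<le> (\<bar>t\<bar> * cmod w) ^ n /\<^sub>R fact n" for n \<theta>
  proof -
    have "\<bar>?x \<theta>\<bar> \<le> cmod w"
      using abs_Re_le_cmod[of "exp (\<i> * of_real \<theta>) * w"] by (simp add: norm_mult)
    then have "(\<bar>t\<bar> * \<bar>?x \<theta>\<bar>) ^ n \<le> (\<bar>t\<bar> * cmod w) ^ n"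
      by (intro power_mono mult_left_mono) auto
    moreover have "norm (f n \<theta>) = (\<bar>t\<bar> * \<bar>?x \<theta>\<bar>) ^ n /\<^sub>R fact n"
      unfolding f_def norm_scaleR norm_power norm_mult norm_of_real abs_mult by simp
    ultimately show ?thesis by (simp add: divide_right_mono field_simps)
  qed
  have meas: "f n \<in> borel_measurable borel" for n
    unfolding f_def by (intro borel_measurable_continuous_onI continuous_intros)
  have int: "integrable circle (f n)" for n
    by (rule integrable_circle_bounded[OF meas bound])
  have summ: "summable (\<lambda>n. norm (f n \<theta>))" for \<theta>
    unfolding f_def by (rule summable_norm_exp)
  have "summable (\<lambda>n. LINT \<theta>|circle. norm (f n \<theta>))"
  proof (rule summable_comparison_test)
    have "(LINT \<theta>|circle. norm (f n \<theta>)) \<le> (\<bar>t\<bar> * cmod w) ^ n /\<^sub>R fact n" for n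
      using bound int by (intro circle.integral_le_const) auto
    then show "\<exists>N. \<forall>n\<ge>N. norm (LINT \<theta>|circle. norm (f n \<theta>)) \<le> (\<bar>t\<bar> * cmod w) ^ n /\<^sub>R fact n"
      by auto
    show "summable (\<lambda>n. (\<bar>t\<bar> * cmod w) ^ n /\<^sub>R fact n)"
      by (rule summable_exp_generic)
  qed
  then have sums: "(\<lambda>n. LINT \<theta>|circle. f n \<theta>) sums (LINT \<theta>|circle. exp (\<i> * of_real (t * ?x \<theta>)))"
    using sums_integral[OF int AE_I2[OF summ]] by (simp add: f_def exp_def)
  have moments: "(LINT \<theta>|circle. f n \<theta>) = (if even n then (\<i> * of_real t) ^ n / fact n *
      (of_nat (n choose (n div 2)) * of_real (cmod w / 2) ^ n) else 0)" for n
  proof -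
    have "f n \<theta> = (\<i> * of_real t) ^ n / fact n * complex_of_real (?x \<theta>) ^ n" for \<theta>
      unfolding f_def by (simp only: of_real_mult power_mult_distrib scaleR_conv_of_real) (simp add: field_simps)
    then show ?thesis by (simp only: integral_mult_right_zero integral_circle_Re_power) simp
  qed
  have even_moments: "(LINT \<theta>|circle. f (2 * m) \<theta>) = of_real ((- (t\<^sup>2 * (cmod w)\<^sup>2 / 4)) ^ m / (fact m)\<^sup>2)" for m
  proof -
    have "(LINT \<theta>|circle. f (2 * m) \<theta>) = (\<i> * of_real t) ^ (2 * m) / fact (2 * m) *
        (of_nat (2 * m choose m) * of_real (cmod w / 2) ^ (2 * m))"
      using moments[of "2 * m"] by simp
    also have "\<dots> = ((\<i> * of_real t) ^ (2 * m) * of_real (cmod w / 2) ^ (2 * m)) *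
        (of_nat (2 * m choose m) / fact (2 * m))"
      by (simp only: divide_inverse mult_ac)
    also have "(\<i> * of_real t) ^ (2 * m) * of_real (cmod w / 2) ^ (2 * m) =
        complex_of_real ((- (t\<^sup>2 * (cmod w)\<^sup>2 / 4)) ^ m)"
      unfolding power_mult power_mult_distrib[symmetric]
      by (simp add: power_mult_distrib power_divide)
    \<comment> \<open>The factorial \<open>fact (2 * m)\<close> of the exponential series cancels
      against the central binomial coefficient, leaving the two factorials of the Bessel
      series.\<close>
    also have "of_nat (2 * m choose m) / fact (2 * m) = complex_of_real (1 / (fact m)\<^sup>2)"
      by (simp add: binomial_fact power2_eq_square)
    finally show ?thesis by simp
  qed
  \<comment> \<open>Since the odd moments vanish, the sum may be reindexed along the even
    numbers.\<close>
  have "(\<lambda>m. LINT \<theta>|circle. f (2 * m) \<theta>) sums (LINT \<theta>|circle. exp (\<i> * of_real (t * ?x \<theta>)))"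
  proof (subst sums_mono_reindex[of "\<lambda>m. 2 * m" "\<lambda>n. LINT \<theta>|circle. f n \<theta>"])
    show "(LINT \<theta>|circle. f n \<theta>) = 0" if "n \<notin> range (\<lambda>m. 2 * m)" for n
      using that by (auto simp: moments)
  qed (use sums in \<open>auto simp: strict_mono_def\<close>)
  then show ?thesis by (simp only: even_moments)
qed

section \<open>Averaging over the exponential law\<close>

text \<open>The exponential law is the Erlang law of shape 0, so the Erlang moment formulas apply to
  the identity as random variable.\<close>

lemma exponential_moments:
  shows "integrable exponential (\<lambda>r. r ^ n)" and "(LINT r|exponential. r ^ n) = fact n"
proof -
  have "distributed exponential lborel (\<lambda>x. x) (exponential_density 1)"
    by (simp add: distributed_def distr_id2)
  from exponential.erlang_ith_moment_integrable[OF _ this] exponential.erlang_ith_moment[OF _ this]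
  show "integrable exponential (\<lambda>r. r ^ n)" "(LINT r|exponential. r ^ n) = fact n"
    by simp_all
qed

lemma AE_exponential_nonneg: "AE r in exponential. 0 \<le> r"
  by (subst AE_density) (auto simp: exponential_density_def)

text \<open>The square root in the phase turns the Bessel series into a power series in
  \<open>r\<close>, so only the moments of the exponential law enter.\<close>

lemma integral_exponential_circle:
  fixes w :: complex
  assumes c: "c \<ge> 0"
  shows "(LINT r|exponential. LINT \<theta>|circle. exp (\<i> * of_real (sqrt (c * r) * Re (exp (\<i> * of_real \<theta>) * w)))) =
    exp (of_real (- (c * (cmod w)\<^sup>2 / 4)))"
proof -
  define K where "K = c * (cmod w)\<^sup>2 / 4"
  define f :: "nat \<Rightarrow> real \<Rightarrow> real" where "f m r = (- K) ^ m / (fact m)\<^sup>2 * r ^ m" for m r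
  let ?J = "\<lambda>r. LINT \<theta>|circle. exp (\<i> * of_real (sqrt (c * r) * Re (exp (\<i> * of_real \<theta>) * w)))"
  have K: "K \<ge> 0" using c by (simp add: K_def)
  have J: "(\<lambda>m. complex_of_real (f m r)) sums ?J r" if "r \<ge> 0" for r
  proof -
    have "(- ((sqrt (c * r))\<^sup>2 * (cmod w)\<^sup>2 / 4)) ^ m / (fact m)\<^sup>2 = f m r" for m
      using c that by (simp add: f_def K_def mult_ac flip: power_mult_distrib)
    with circle_characteristic_sums[of "sqrt (c * r)" w] show ?thesis by simp
  qed
  have int: "integrable exponential (f m)" for m
    unfolding f_def by (intro integrable_mult_right exponential_moments)
  have f_abs: "norm (f m r) = K ^ m / (fact m)\<^sup>2 * r ^ m" if "r \<ge> 0" for m r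
    using that K by (simp add: f_def abs_mult power_abs)
  have summ: "summable (\<lambda>m. norm (f m r))" if "r \<ge> 0" for r
  proof (rule summable_comparison_test)
    have "norm (f m r) \<le> (K * r) ^ m /\<^sub>R fact m" for m
    proof -
      \<comment> \<open>Dropping one factorial, which is at least 1, compares the series with that
        of \<open>exp (K * r)\<close>.\<close>
      have "(K * r) ^ m / (fact m * fact m) \<le> (K * r) ^ m / (fact m * 1)"
        using K that by (intro divide_left_mono mult_left_mono) auto
      moreover have "norm (f m r) = (K * r) ^ m / (fact m * fact m)"
        by (simp only: f_abs[OF that] power2_eq_square power_mult_distrib times_divide_eq_left)
      ultimately show ?thesis by (simp add: divide_inverse mult.commute)
    qed
    then show "\<exists>N. \<forall>m\<ge>N. norm (norm (f m r)) \<le> (K * r) ^ m /\<^sub>R fact m" by auto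
    show "summable (\<lambda>m. (K * r) ^ m /\<^sub>R fact m)" by (rule summable_exp_generic)
  qed
  \<comment> \<open>These values are the terms of the series of \<open>exp K\<close>; their
    summability is what the exchange of sum and integral requires.\<close>
  have "(LINT r|exponential. norm (f m r)) = K ^ m /\<^sub>R fact m" for m
  proof -
    have "(LINT r|exponential. norm (f m r)) = (LINT r|exponential. K ^ m / (fact m)\<^sup>2 * r ^ m)"
    proof (intro integral_cong_AE)
      show "AE r in exponential. norm (f m r) = K ^ m / (fact m)\<^sup>2 * r ^ m"
        using AE_exponential_nonneg by eventually_elim (rule f_abs)
    qed (use int[of m] in auto)
    then show ?thesis by (simp add: exponential_moments power2_eq_square field_simps)
  qed
  then have "(\<lambda>m. LINT r|exponential. f m r) sums (LINT r|exponential. (\<Sum>m. f m r))"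
    using summ AE_exponential_nonneg summable_exp_generic[of K]
    by (intro sums_integral int) auto
  moreover have "(LINT r|exponential. f m r) = (- K) ^ m /\<^sub>R fact m" for m
    by (simp add: f_def exponential_moments power2_eq_square field_simps)
  ultimately have "(LINT r|exponential. (\<Sum>m. f m r)) = exp (- K)"
    by (simp add: exp_def sums_iff)
  have "(LINT r|exponential. ?J r) = (LINT r|exponential. complex_of_real (\<Sum>m. f m r))"
  proof (intro integral_cong_AE)
    \<comment> \<open>The series for \<open>?J r\<close> was derived for \<open>r \<ge> 0\<close>
      only, which is almost everywhere.\<close>
    show "AE r in exponential. ?J r = complex_of_real (\<Sum>m. f m r)"
      using AE_exponential_nonneg
    proof eventually_elim
      case (elim r)
      then have "(\<lambda>m. complex_of_real (f m r)) sums complex_of_real (\<Sum>m. f m r)"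
        using summable_norm_cancel[OF summ[OF elim]] by (intro sums_of_real summable_sums)
      with J[OF elim] show ?case by (rule sums_unique2)
    qed
    \<comment> \<open>Joint continuity gives joint measurability, hence measurability in
      \<open>r\<close> after integrating out \<theta>.\<close>
    have "(\<lambda>(r, \<theta>). exp (\<i> * of_real (sqrt (c * r) * Re (exp (\<i> * of_real \<theta>) * w))) :: complex)
        \<in> borel_measurable (borel \<Otimes>\<^sub>M borel)"
      unfolding borel_prod case_prod_unfold by (intro borel_measurable_continuous_onI continuous_intros)
    then show "?J \<in> borel_measurable exponential"
      by (simp add: circle.borel_measurable_lebesgue_integral cong: measurable_cong_sets)
  qed (use int in \<open>simp add: f_def\<close>)
  also have "\<dots> = exp (of_real (- K))"
    by (simp only: integral_complex_of_real \<open>(LINT r|exponential. (\<Sum>m. f m r)) = exp (- K)\<close> exp_of_real)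
  finally show ?thesis by (simp add: K_def)
qed

section \<open>The measure \<open>chi\<close> as a product\<close>

lemma polar_strip_measurable [measurable]: "polar_strip \<in> sets borel"
  unfolding polar_strip_def by (intro borel_Times) auto

lemma chi_density_measurable:
  "(\<lambda>(r, \<theta>). ennreal (indicator polar_strip (r, \<theta>) * (exp (- r) / (2 * pi)))) \<in> borel_measurable borel"
proof -
  have [measurable]: "fst \<in> borel_measurable (borel :: (real \<times> real) measure)"
    by (intro borel_measurable_continuous_onI continuous_intros)
  have "(\<lambda>z. ennreal (indicator polar_strip z * (exp (- fst z) / (2 * pi)))) \<in> borel_measurable borel"
    by measurable
  then show ?thesis by (simp add: case_prod_unfold)
qed

text \<open>The density factorizes: \<open>exp (- r)\<close> on the half-line belongs to the radial
  law, and \<open>1 / (2 * pi)\<close> normalizes the angle. This makes Fubini available.\<close>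

lemma chi_eq_pair_measure: "chi = exponential \<Otimes>\<^sub>M circle"
proof -
  have "chi = density (lborel \<Otimes>\<^sub>M lborel)
      (\<lambda>(r, \<theta>). ennreal (exponential_density 1 r) * (indicator {0..<2 * pi} \<theta> / emeasure lborel {0..<2 * pi}))"
    unfolding chi_def lborel_prod
  proof (intro density_cong)
    show "(\<lambda>(r, \<theta>). ennreal (exponential_density 1 r) *
        (indicator {0..<2 * pi} \<theta> / emeasure lborel {0..<2 * pi})) \<in> borel_measurable lborel"
      unfolding lborel_prod[symmetric] by measurable
    show "AE z in lborel. (case z of (r, \<theta>) \<Rightarrow> ennreal (indicator polar_strip (r, \<theta>) * (exp (- r) / (2 * pi)))) =
        (case z of (r, \<theta>) \<Rightarrow> ennreal (exponential_density 1 r) *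
          (indicator {0..<2 * pi} \<theta> / emeasure lborel {0..<2 * pi}))"
      by (intro AE_I2) (auto simp: polar_strip_def indicator_def exponential_density_def divide_ennreal
         simp flip: ennreal_mult'' ennreal_1)
  qed (use chi_density_measurable in simp)
  also have "\<dots> = exponential \<Otimes>\<^sub>M circle"
    using circle.sigma_finite_measure_axioms unfolding uniform_measure_def
    by (intro pair_measure_density[symmetric]) (auto intro: sigma_finite_lborel)
  finally show ?thesis .
qed

interpretation chi: prob_space chi
  unfolding chi_eq_pair_measure
  by (rule prob_space_pair) unfold_locales

lemma sets_chi [simp, measurable_cong]: "sets chi = sets borel"
  by (simp add: chi_def)

lemma space_chi [simp]: "space chi = UNIV"
  by (simp add: chi_def)

text \<open>Properties of the component spaces assumed only on the strip thereby hold almost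
  everywhere.\<close>

lemma AE_chi_polar_strip: "AE z in chi. z \<in> polar_strip"
  unfolding chi_def using chi_density_measurable
  by (subst AE_density) (auto simp: indicator_def of_bool_def split: if_splits)

section \<open>Existence, uniqueness and disintegration of the mixture\<close>

lemma ex1_is_mixture:
  assumes \<mu>: "\<mu> \<in> measurable borel (prob_algebra S)"
  shows "\<exists>!M. is_mixture S \<mu> M"
proof (rule ex_ex1I)
  have \<mu>' [measurable]: "\<mu> \<in> measurable chi (subprob_algebra S)"
    using measurable_prob_algebraD[OF \<mu>] by (simp cong: measurable_cong_sets)
  have sets_\<mu> [measurable_cong]: "sets (\<mu> z) = sets S" and prob_\<mu>: "prob_space (\<mu> z)" for z
    using measurable_space[OF \<mu>] by (auto simp: space_prob_algebra)
  \<comment> \<open>The witness spreads \<open>\<mu> z\<close> over the slice above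
    \<open>z\<close>, that is, it is the product of \<open>\<mu> z\<close> with the point mass at
    \<open>z\<close>; averaging over \<open>chi\<close> assembles the slices.\<close>
  define K where "K z = distr (\<mu> z) (S \<Otimes>\<^sub>M borel) (\<lambda>x. (x, z))" for z
  have K: "K \<in> measurable chi (subprob_algebra (S \<Otimes>\<^sub>M borel))"
    unfolding K_def by (rule measurable_distr2[OF _ \<mu>']) measurable
  have K_prob: "prob_space (K z)" for z
    unfolding K_def by (intro prob_space.prob_space_distr prob_\<mu>) measurable
  have P: "prob_space (chi \<bind> K)"
    using K_prob by (intro chi.prob_space_bind[OF _ K]) auto
  have "measure (chi \<bind> K) (A \<times> B) = (LINT z:B|chi. measure (\<mu> z) A)"
    if [measurable]: "A \<in> sets S" "B \<in> sets borel" for A B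
  proof -
    have "measure (K z) (A \<times> B) = indicator B z *\<^sub>R measure (\<mu> z) A" for z
    proof -
      have "measure (K z) (A \<times> B) = measure (\<mu> z) ((\<lambda>x. (x, z)) -` (A \<times> B) \<inter> space (\<mu> z))"
        unfolding K_def by (rule measure_distr) measurable
      also have "(\<lambda>x. (x, z)) -` (A \<times> B) \<inter> space (\<mu> z) = (if z \<in> B then A else {})"
        using sets.sets_into_space[OF \<open>A \<in> sets S\<close>] sets_eq_imp_space_eq[OF sets_\<mu>, of z] by auto
      finally show ?thesis by simp
    qed
    then show ?thesis
      by (simp add: chi.measure_bind[OF K] set_lebesgue_integral_def)
  qed
  then show "\<exists>M. is_mixture S \<mu> M"
    using P sets_bind_measurable[OF K] unfolding is_mixture_def by auto
next
  fix M N assume M: "is_mixture S \<mu> M" and N: "is_mixture S \<mu> N"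
  interpret M: prob_space M using M by (simp add: is_mixture_def)
  interpret N: prob_space N using N by (simp add: is_mixture_def)
  let ?E = "{A \<times> B | A B. A \<in> sets S \<and> B \<in> sets (borel :: (real \<times> real) measure)}"
  show "M = N"
  \<comment> \<open>Measurable rectangles are closed under intersection. Both measures are finite,
    so the constant sequence of the whole space serves as exhaustion.\<close>
  proof (rule measure_eqI_generator_eq[where E = ?E and \<Omega> = "space S \<times> UNIV" and A = "\<lambda>_. space S \<times> UNIV"])
    show "sets M = sigma_sets (space S \<times> UNIV) ?E" "sets N = sigma_sets (space S \<times> UNIV) ?E"
      using M N by (simp_all add: is_mixture_def sets_pair_measure)
    show "emeasure M X = emeasure N X" if "X \<in> ?E" for X
      using that M N by (auto simp: is_mixture_def M.emeasure_eq_measure N.emeasure_eq_measure)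
    show "range (\<lambda>_::nat. space S \<times> UNIV) \<subseteq> ?E"
      by (auto intro!: exI[of _ "space S"])
  qed (use pair_measure_closed[of S borel] in \<open>auto simp: Int_stable_pair_measure_generator\<close>)
qed

text \<open>Taking the whole plane for \<open>B\<close> in the rectangle formula integrates out the
  second coordinate.\<close>

lemma is_mixture_marginal:
  assumes \<mu>: "\<mu> \<in> measurable borel (prob_algebra S)" and M: "is_mixture S \<mu> M"
  shows "distr M S fst = chi \<bind> \<mu>"
proof (rule measure_eqI)
  have \<mu>': "\<mu> \<in> measurable chi (subprob_algebra S)"
    using measurable_prob_algebraD[OF \<mu>] by (simp cong: measurable_cong_sets)
  interpret M: prob_space M using M by (simp add: is_mixture_def)
  have sets_M [measurable_cong]: "sets M = sets (S \<Otimes>\<^sub>M borel)"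
    using M by (simp add: is_mixture_def)
  have prob_bind: "prob_space (chi \<bind> \<mu>)"
    using measurable_space[OF \<mu>] by (intro chi.prob_space_bind[OF _ \<mu>']) (auto simp: space_prob_algebra)
  show "sets (distr M S fst) = sets (chi \<bind> \<mu>)"
    by (simp add: sets_bind_measurable[OF \<mu>'])
  fix A assume "A \<in> sets (distr M S fst)"
  then have A [measurable]: "A \<in> sets S" by simp
  have "fst -` A \<inter> space M = A \<times> UNIV"
    using sets.sets_into_space[OF A] sets_eq_imp_space_eq[OF sets_M] by (auto simp: space_pair_measure)
  then have "emeasure (distr M S fst) A = measure M (A \<times> UNIV)"
    by (simp add: emeasure_distr M.emeasure_eq_measure)
  also have "measure M (A \<times> UNIV) = (LINT z:UNIV|chi. measure (\<mu> z) A)"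
    using M A by (simp add: is_mixture_def)
  also have "\<dots> = measure (chi \<bind> \<mu>) A"
    by (simp add: set_lebesgue_integral_def chi.measure_bind[OF \<mu>' A])
  also have "ennreal \<dots> = emeasure (chi \<bind> \<mu>) A"
    using prob_bind by (simp add: prob_space_def finite_measure.emeasure_eq_measure)
  finally show "emeasure (distr M S fst) A = emeasure (chi \<bind> \<mu>) A" .
qed

text \<open>A function of the first coordinate sees only the marginal, so a change of variables
  along \<open>fst\<close> reduces everything to the bind formulas.\<close>

lemma integral_is_mixture:
  fixes F :: "'a \<Rightarrow> 'b::{banach, second_countable_topology}"
  assumes \<mu>: "\<mu> \<in> measurable borel (prob_algebra S)" and M: "is_mixture S \<mu> M"
    and F: "F \<in> borel_measurable S" "integrable M (\<lambda>p. F (fst p))"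
  shows "AE z in chi. integrable (\<mu> z) F"
    and "integrable chi (\<lambda>z. LINT x|\<mu> z. F x)"
    and "(LINT p|M. F (fst p)) = (LINT z|chi. (LINT x|\<mu> z. F x))"
proof -
  have \<mu>': "\<mu> \<in> measurable chi (subprob_algebra S)"
    using measurable_prob_algebraD[OF \<mu>] by (simp cong: measurable_cong_sets)
  have fst: "fst \<in> measurable M S"
    using M by (simp add: is_mixture_def cong: measurable_cong_sets)
  note marginal = is_mixture_marginal[OF \<mu> M]
  have int: "integrable (chi \<bind> \<mu>) F"
    using F integrable_distr_eq[OF fst F(1)] by (simp add: marginal)
  show "AE z in chi. integrable (\<mu> z) F"
    and "integrable chi (\<lambda>z. LINT x|\<mu> z. F x)"
    using AE_integrable_bind[OF \<mu>' _ int] integrable_integral_bind[OF \<mu>' _ int] by simp_all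
  show "(LINT p|M. F (fst p)) = (LINT z|chi. (LINT x|\<mu> z. F x))"
    using integral_distr[OF fst F(1)] lebesgue_integral_bind[OF \<mu>' _ int] by (simp add: marginal)
qed

section \<open>Averaging the component states\<close>

text \<open>The factor with \<open>q_nz\<close> is independent of \<open>(r, \<theta>)\<close> and
  leaves the integral. The phase depends on \<open>f\<close> only through the number
  \<open>w = fourier f 0\<close>, and \<open>c * (cmod w)\<^sup>2\<close> is
  \<open>q_0\<close>.\<close>

lemma integral_psi_component:
  assumes "\<rho>0 \<ge> 0"
  shows "(LINT (r, \<theta>)|chi. psi_component \<beta> s \<rho>0 r \<theta> f) = psi_BEC \<beta> s \<rho>0 f"
proof -
  interpret pair_sigma_finite exponential circle ..
  define c where "c = 2 * (2 * pi) ^ 3 * \<rho>0"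
  have c: "c \<ge> 0" using assms by (simp add: c_def)
  let ?g = "\<lambda>(r, \<theta>). exp (\<i> * of_real (ell \<rho>0 r \<theta> f))"
  have "?g \<in> borel_measurable borel"
    unfolding ell_def case_prod_unfold by (intro borel_measurable_continuous_onI continuous_intros)
  then have "integrable chi ?g"
    by (intro chi.integrable_const_bound[where B = 1]) (auto cong: measurable_cong_sets)
  then have "(LINT z|chi. ?g z) = (LINT r|exponential. LINT \<theta>|circle. exp (\<i> * of_real (ell \<rho>0 r \<theta> f)))"
    unfolding chi_eq_pair_measure by (subst integral_fst'[symmetric]) simp_all
  also have "\<dots> = exp (of_real (- (c * (cmod (fourier f 0))\<^sup>2 / 4)))"
    using integral_exponential_circle[OF c, of "fourier f 0"] by (simp add: ell_def c_def)
  finally have "(LINT z|chi. ?g z) = exp (of_real (- (1 / 4) * q_0 \<rho>0 f))"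
    by (simp add: q_0_def c_def)
  moreover have "psi_component \<beta> s \<rho>0 r \<theta> f = exp (of_real (- (1 / 4) * q_nz \<beta> s f)) * ?g (r, \<theta>)" for r \<theta>
    by (simp only: psi_component_def exp_add prod.case)
  then have "(LINT (r, \<theta>)|chi. psi_component \<beta> s \<rho>0 r \<theta> f) =
      exp (of_real (- (1 / 4) * q_nz \<beta> s f)) * (LINT z|chi. ?g z)"
    by (simp only: case_prod_unfold prod.collapse integral_mult_right_zero)
  ultimately show ?thesis
    by (simp only: psi_BEC_def exp_add[symmetric] of_real_add[symmetric] distrib_left add.commute)
qed

section \<open>The path space of the BEC state\<close>

text \<open>The time-zero algebra is the same for all components and is contained in the
  \<sigma>-algebra of each path space, which is that of \<open>S\<close>. One point of the strip,
  here the origin, therefore suffices.\<close>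

lemma (in component_path_spaces) field_measurable:
  assumes "f \<in> D0_real \<beta> s"
  shows "\<phi> f \<in> borel_measurable S"
proof (rule measurableI)
  have strip: "(0, 0) \<in> polar_strip"
    by (simp add: polar_strip_def)
  interpret P: beta_markov_path_space "\<mu> (0, 0)" "time_zero_algebra (D0_real \<beta> s) \<phi>" U R \<beta>
    using strip by (rule path_space)
  fix B :: "real set" assume "B \<in> sets borel"
  then have "\<phi> f -` B \<in> sets (time_zero_algebra (D0_real \<beta> s) \<phi>)"
    using assms unfolding time_zero_algebra_def by (auto simp: sets_measure_of)
  also have "\<dots> \<subseteq> sets (\<mu> (0, 0))"
    using P.sub_algebra by (simp add: subalgebra_def)
  also have "\<dots> = sets S"
    using measurable_space[OF transition_probability, of "(0, 0)"] by (simp add: space_prob_algebra)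
  finally show "\<phi> f -` B \<inter> space S \<in> sets S"
    by (simp add: space_S)
qed simp

theorem proposition3p27:
  fixes \<beta> s \<rho>0 :: real
    and S :: "'q::{real_inner, banach, second_countable_topology} measure"
    and \<phi> :: "(R3 \<Rightarrow> real) \<Rightarrow> 'q \<Rightarrow> real"
    and U :: "real \<Rightarrow> 'q \<Rightarrow> 'q" and R :: "'q \<Rightarrow> 'q"
    and \<mu> :: "real \<times> real \<Rightarrow> 'q measure"
  assumes "s \<ge> 1" and "\<beta> > 0" and "\<rho>0 > 0"
    and "component_path_spaces \<beta> s \<rho>0 S \<phi> U R \<mu>"
  shows "(\<exists>!M. is_mixture S \<mu> M) \<and>
    (\<forall>M. is_mixture S \<mu> M \<longrightarrow>
       corresponds_to M (D0_real \<beta> s) (\<lambda>f p. \<phi> f (fst p)) (psi_BEC \<beta> s \<rho>0) \<and>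
       (\<forall>F :: 'q \<Rightarrow> ennreal. F \<in> borel_measurable S \<longrightarrow>
          (\<integral>\<^sup>+ p. F (fst p) \<partial>M) = (\<integral>\<^sup>+ z. (\<integral>\<^sup>+ x. F x \<partial>\<mu> z) \<partial>chi)) \<and>
       (\<forall>F :: 'q \<Rightarrow> 'b::{banach, second_countable_topology}.
          F \<in> borel_measurable S \<and> integrable M (\<lambda>p. F (fst p)) \<longrightarrow>
          (AE z in chi. integrable (\<mu> z) F) \<and>
          integrable chi (\<lambda>z. LINT x|\<mu> z. F x) \<and>
          (LINT p|M. F (fst p)) = (LINT z|chi. (LINT x|\<mu> z. F x))))"
proof (intro conjI allI impI)
  interpret component_path_spaces \<beta> s \<rho>0 S \<phi> U R \<mu> by fact
  show "\<exists>!M. is_mixture S \<mu> M"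
    by (rule ex1_is_mixture[OF transition_probability])
  have \<mu>: "\<mu> \<in> measurable chi (subprob_algebra S)"
    using measurable_prob_algebraD[OF transition_probability] by (simp cong: measurable_cong_sets)
  fix M assume M: "is_mixture S \<mu> M"
  note marginal = is_mixture_marginal[OF transition_probability M]
  have sets_M [measurable_cong]: "sets M = sets (S \<Otimes>\<^sub>M borel)"
    using M by (simp add: is_mixture_def)
  have fst [measurable]: "fst \<in> measurable M S"
    by measurable
  {
    fix F :: "'q \<Rightarrow> ennreal" assume F [measurable]: "F \<in> borel_measurable S"
    show "(\<integral>\<^sup>+ p. F (fst p) \<partial>M) = (\<integral>\<^sup>+ z. (\<integral>\<^sup>+ x. F x \<partial>\<mu> z) \<partial>chi)"
    proof -
      have "F \<in> borel_measurable (distr M S fst)"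
        using F by simp
      from nn_integral_distr[OF fst this] show ?thesis
        by (simp add: marginal nn_integral_bind[OF F \<mu>])
    qed
  next
    fix F :: "'q \<Rightarrow> 'b" assume F: "F \<in> borel_measurable S \<and> integrable M (\<lambda>p. F (fst p))"
    show "AE z in chi. integrable (\<mu> z) F"
      and "integrable chi (\<lambda>z. LINT x|\<mu> z. F x)"
      and "(LINT p|M. F (fst p)) = (LINT z|chi. (LINT x|\<mu> z. F x))"
      using F by (auto intro: integral_is_mixture[OF transition_probability M])
  next
    show "corresponds_to M (D0_real \<beta> s) (\<lambda>f p. \<phi> f (fst p)) (psi_BEC \<beta> s \<rho>0)"
      unfolding corresponds_to_def
    proof
      fix f assume f: "f \<in> D0_real \<beta> s"
      interpret M: prob_space M using M by (simp add: is_mixture_def)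
      let ?F = "\<lambda>x. exp (\<i> * complex_of_real (\<phi> f x))"
      have [measurable]: "\<phi> f \<in> borel_measurable S"
        using f by (rule field_measurable)
      \<comment> \<open>The phase has modulus 1, so it is integrable under the probability measure
        \<open>M\<close> and the disintegration applies.\<close>
      have F: "?F \<in> borel_measurable S" "integrable M (\<lambda>p. ?F (fst p))"
        by (auto intro!: M.integrable_const_bound[where B = 1])
      have "(LINT p|M. ?F (fst p)) = (LINT z|chi. (LINT x|\<mu> z. ?F x))"
        by (rule integral_is_mixture[OF transition_probability M F])
      also have "\<dots> = (LINT (r, \<theta>)|chi. psi_component \<beta> s \<rho>0 r \<theta> (cplx f))"
      proof (intro integral_cong_AE)
        show "(\<lambda>z. LINT x|\<mu> z. ?F x) \<in> borel_measurable chi"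
          using integral_is_mixture(2)[OF transition_probability M F] by simp
        show "(\<lambda>(r, \<theta>). psi_component \<beta> s \<rho>0 r \<theta> (cplx f)) \<in> borel_measurable chi"
          unfolding psi_component_def ell_def case_prod_unfold measurable_cong_sets[OF sets_chi refl]
          by (intro borel_measurable_continuous_onI continuous_intros)
        show "AE z in chi. (LINT x|\<mu> z. ?F x) = (case z of (r, \<theta>) \<Rightarrow> psi_component \<beta> s \<rho>0 r \<theta> (cplx f))"
          using AE_chi_polar_strip
        proof eventually_elim
          case (elim z)
          with component[of "fst z" "snd z"] f show ?case
            by (simp add: corresponds_to_def case_prod_unfold)
        qed
      qed
      also have "\<dots> = psi_BEC \<beta> s \<rho>0 (cplx f)"
        using \<open>\<rho>0 > 0\<close> by (intro integral_psi_component) simp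
      finally show "(LINT p|M. ?F (fst p)) = psi_BEC \<beta> s \<rho>0 (cplx f)" .
    qed
  }
qed

end
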